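(* Let $T\colon \mathscr{P}(\mathbb{C})\to \mathscr{P}(\mathbb{C})$ be a mapping (not assumed to be linear or additive). Then $T$ satisfies the Leibniz rule $$T(p\cdot q)=T(p)\cdot q+p\cdot T(q)\qquad\text{for all } p,q\in \mathscr{P}(\mathbb{C})$$ and decreases the degree if and only if there exist two functions $\psi_0,\tilde\varphi_0\colon\mathbb{C}\to\mathbb{C}$ such that $\tilde\varphi_0(ab)=a\tilde\varphi_0(b)+b\tilde\varphi_0(a)$ for all $a,b\in\mathbb{C}$ and such that, for every $p\in\mathscr{P}(\mathbb{C})$ written as $p(z)=a\prod_{j=1}^{N}(z-z_j)$ with $N\in\mathbb{N}_0$ and $a,z_1,\dots,z_N\in\mathbb{C}$, one has for all $z\in\mathbb{C}$ $$T(p)(z)=a\sum_{j=1}^{N}\Big(\prod_{i\neq j}(z-z_i)\Big)\big(\psi_0(-z_j)+\tilde\varphi_0(-z_j)\big).$$ Consequently, for such $T$, for each monomial $p(z)=z^N$ there exists a constant $c_p\in\mathbb{C}$ such that $T(p)=c_p\cdot p'$.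
   Context: $\mathscr{P}(\mathbb{C})$ denotes the set of all polynomials $p\colon\mathbb{C}\to\mathbb{C}$ with complex coefficients (including the zero polynomial), with pointwise multiplication and addition. $\mathbb{N}_0=\{0,1,2,\dots\}$. An operator $T\colon\mathscr{P}(\mathbb{C})\to\mathscr{P}(\mathbb{C})$ decreases the degree if for any polynomial $p$ of degree $N$ the degree of $T(p)$ is smaller than $N$; here $p$ ranges over nonzero polynomials (so $N\in\mathbb{N}_0$) and the zero polynomial has degree $-\infty$. In $\prod_{i\neq j}$ the index $i$ ranges over $\{1,\dots,N\}\setminus\{j\}$; empty products equal $1$ and empty sums equal $0$ (so constants $p=a$ correspond to $N=0$). $p'$ is the derivative of $p$. *)

theory Defs
  imports Complex_Main "HOL-Library.Extended_Real" "HOL-Computational_Algebra.Polynomial"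
begin

text \<open>The library sets \<open>degree 0 = 0\<close>; here the zero polynomial has degree \<open>-\<infinity>\<close>.\<close>

definition ext_degree :: "complex poly \<Rightarrow> ereal" where
  "ext_degree p = (if p = 0 then -\<infinity> else ereal (real (degree p)))"

text \<open>In particular, an operator that decreases the degree annihilates the nonzero constants.\<close>

definition decreases_degree :: "(complex poly \<Rightarrow> complex poly) \<Rightarrow> bool" where
  "decreases_degree T \<longleftrightarrow> (\<forall>p. p \<noteq> 0 \<longrightarrow> ext_degree (T p) < ext_degree p)"

definition leibniz_rule :: "(complex poly \<Rightarrow> complex poly) \<Rightarrow> bool" where
  "leibniz_rule T \<longleftrightarrow> (\<forall>p q. T (p * q) = T p * q + p * T q)"

end

theory Submission
  imports Defs "HOL-Computational_Algebra.Fundamental_Theorem_Algebra"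
begin

text \<open>
  A Leibniz operator is determined by its values on factors, and over \<open>\<complex>\<close> every polynomial is a
  constant times a product of linear factors \<open>z - w\<close>. If the operator also decreases the degree, it
  kills the constants and sends \<open>z - w\<close> to a constant \<open>d w\<close>; the product rule for finitely many
  factors (\<open>leibniz_rule_prod\<close>) then is the asserted formula for \<open>\<psi> x = d (- x)\<close> and \<open>\<phi> = 0\<close>. In a
  monomial all linear factors are \<open>z\<close>, so the product rule contains the single constant \<open>d 0\<close>, and
  the same rule for the derivative shows that \<open>T\<close> is \<open>d 0\<close> times the derivative there.

  Conversely, with \<open>d w = \<psi> (- w) + \<phi> (- w)\<close> the formula implies that
  \<open>T\<close> is homogeneous, annihilates constants and satisfies \<open>T ((z - w) * p) = d w
  * p + (z - w) * T p\<close>. Since every complex polynomial arises from a constant by multiplying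
  with linear factors (\<open>complex_poly_linear_factor_induct\<close>), the Leibniz rule for
  \<open>p * q\<close> and the bound on the degree of \<open>T p\<close> both follow by adding one
  factor of \<open>p\<close> at a time.
\<close>

text \<open>The shape of the induction spares the bookkeeping of concatenating two lists of zeros when
  two factorised polynomials are multiplied.\<close>

lemma complex_poly_linear_factor_induct [case_names const factor]:
  fixes p :: "complex poly"
  assumes const: "\<And>a. P [:a:]"
    and factor: "\<And>w p. P p \<Longrightarrow> P ([:- w, 1:] * p)"
  shows "P p"
proof (induction "degree p" arbitrary: p)
  case 0
  then show ?case
    using const by (metis degree_eq_zeroE)
next
  case (Suc n)
  then have "\<not> constant (poly p)"
    by (simp add: constant_degree)
  then obtain w where "poly p w = 0"
    using fundamental_theorem_of_algebra by blast
  then obtain q where q: "p = [:- w, 1:] * q"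
    by (metis poly_eq_0_iff_dvd dvdE)
  with Suc.hyps(2) have "q \<noteq> 0"
    by auto
  then have "degree p = Suc (degree q)"
    unfolding q by (subst degree_mult_eq) auto
  with Suc.hyps q show ?case
    using factor by simp
qed

lemma complex_poly_factorization:
  fixes p :: "complex poly"
  shows "\<exists>a (N :: nat) zs. \<forall>z. poly p z = a * (\<Prod>j=1..N. (z - zs j))"
proof (induction p rule: complex_poly_linear_factor_induct)
  case (const a)
  show ?case
    by (intro exI [of _ a] exI [of _ "0 :: nat"]) simp
next
  case (factor w p)
  then obtain a zs and N :: nat where p: "\<And>z. poly p z = a * (\<Prod>j=1..N. (z - zs j))"
    by blast
  have "poly ([:- w, 1:] * p) z = a * (\<Prod>j=1..Suc N. (z - (zs(Suc N := w)) j))" for z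
    by (simp add: p algebra_simps)
  then show ?case
    by (intro exI allI)
qed

text \<open>How the expression on the right of the product rule changes when a factor is added; needed
  for polynomials in one direction and for their values in the other.\<close>

lemma sum_prod_except_insert:
  fixes f d :: "'i \<Rightarrow> 'a :: comm_semiring_1"
  assumes "finite I" and "k \<notin> I"
  shows "(\<Sum>j\<in>insert k I. (\<Prod>i\<in>insert k I - {j}. f i) * d j) =
    (\<Prod>i\<in>I. f i) * d k + f k * (\<Sum>j\<in>I. (\<Prod>i\<in>I - {j}. f i) * d j)"
proof -
  have "(\<Prod>i\<in>insert k I - {j}. f i) = f k * (\<Prod>i\<in>I - {j}. f i)" if "j \<in> I" for j
  proof -
    have "insert k I - {j} = insert k (I - {j})"
      using that assms by auto
    then show ?thesis
      using assms by simp
  qed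
  then have "(\<Sum>j\<in>I. (\<Prod>i\<in>insert k I - {j}. f i) * d j) =
      f k * (\<Sum>j\<in>I. (\<Prod>i\<in>I - {j}. f i) * d j)"
    by (simp add: sum_distrib_left mult.assoc)
  moreover have "insert k I - {k} = I"
    using assms by auto
  ultimately show ?thesis
    using assms by simp
qed

lemma leibniz_rule_one:
  assumes "leibniz_rule T"
  shows "T 1 = 0"
proof -
  have "T (1 * 1) = T 1 * 1 + 1 * T 1"
    using assms unfolding leibniz_rule_def by blast
  then show ?thesis
    by simp
qed

lemma leibniz_rule_prod:
  assumes T: "leibniz_rule T" and "finite I"
  shows "T (\<Prod>i\<in>I. f i) = (\<Sum>j\<in>I. (\<Prod>i\<in>I - {j}. f i) * T (f j))"
  using \<open>finite I\<close>
proof (induction rule: finite_induct)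
  case empty
  show ?case
    by (simp add: leibniz_rule_one [OF T])
next
  case (insert k I)
  have "T (\<Prod>i\<in>insert k I. f i) = T (f k) * (\<Prod>i\<in>I. f i) + f k * T (\<Prod>i\<in>I. f i)"
    using T insert.hyps unfolding leibniz_rule_def by simp
  then show ?case
    using insert.hyps sum_prod_except_insert [of I k f "\<lambda>j. T (f j)"]
    by (simp add: insert.IH add.commute mult.commute)
qed

lemma leibniz_rule_monom:
  fixes T :: "complex poly \<Rightarrow> complex poly"
  assumes T: "leibniz_rule T" and const: "T [:0, 1:] = [:c:]"
  shows "T (monom 1 N) = smult c (pderiv (monom 1 N))"
proof -
  have "T (\<Prod>i<N. [:0, 1:]) = (\<Sum>j<N. (\<Prod>i\<in>{..<N} - {j}. [:0, 1:]) * [:c:])"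
    by (simp only: leibniz_rule_prod [OF T] const finite_lessThan)
  moreover have "pderiv (monom 1 N :: complex poly) = smult (of_nat N) ([:0, 1:] ^ (N - 1))"
    unfolding pderiv_monom unfolding monom_altdef by simp
  ultimately show ?thesis
    by (simp add: monom_altdef [of 1 N] of_nat_poly)
qed

lemma decreases_degree_const:
  assumes "decreases_degree T" and "a \<noteq> 0"
  shows "T [:a:] = 0"
  using assms unfolding decreases_degree_def ext_degree_def
  by (auto dest!: spec [of _ "[:a:]"] split: if_splits)

lemma decreases_degree_linear:
  assumes "decreases_degree T"
  obtains c where "T [:b, 1:] = [:c:]"
proof -
  have "degree (T [:b, 1:]) = 0"
    using assms unfolding decreases_degree_def ext_degree_def
    by (auto dest!: spec [of _ "[:b, 1:]"] split: if_splits)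
  with that show thesis
    by (metis degree_eq_zeroE)
qed

text \<open>Degrees say nothing about \<open>T 0\<close>, which is governed by \<open>0 = 0 * 0\<close> instead.\<close>

lemma leibniz_rule_const:
  assumes "leibniz_rule T" and "decreases_degree T"
  shows "T [:a:] = 0"
proof (cases "a = 0")
  case True
  have "T (0 * 0) = T 0 * 0 + 0 * T 0"
    using assms(1) unfolding leibniz_rule_def by blast
  with True show ?thesis
    by simp
qed (use assms(2) decreases_degree_const in blast)

lemma leibniz_rule_factorization:
  fixes T :: "complex poly \<Rightarrow> complex poly"
  assumes T: "leibniz_rule T" "decreases_degree T"
    and d: "\<And>w. T [:- w, 1:] = [:d w:]"
    and p: "\<And>z. poly p z = a * (\<Prod>j\<in>I. (z - zs j))"
    and "finite I"
  shows "poly (T p) z = a * (\<Sum>j\<in>I. (\<Prod>i\<in>I - {j}. (z - zs i)) * d (zs j))"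
proof -
  have "p = [:a:] * (\<Prod>j\<in>I. [:- zs j, 1:])"
    by (rule poly_ext) (simp add: p poly_prod)
  then have "T p = T [:a:] * (\<Prod>j\<in>I. [:- zs j, 1:]) + [:a:] * T (\<Prod>j\<in>I. [:- zs j, 1:])"
    using T(1) unfolding leibniz_rule_def by blast
  then have "T p = [:a:] * T (\<Prod>j\<in>I. [:- zs j, 1:])"
    by (simp add: leibniz_rule_const [OF T])
  then show ?thesis
    by (simp add: leibniz_rule_prod [OF T(1) \<open>finite I\<close>] d poly_sum poly_prod mult.commute)
qed

text \<open>The recursive description of an operator that is determined by its values \<open>d w\<close> on the linear
  factors \<open>z - w\<close>; by induction over the factors it gives both properties of the operator.\<close>

locale linear_factor_operator =
  fixes T :: "complex poly \<Rightarrow> complex poly" and d :: "complex \<Rightarrow> complex"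
  assumes const_eq_0: "T [:a:] = 0"
    and smult_eq: "T (smult a p) = smult a (T p)"
    and factor_eq: "T ([:- w, 1:] * p) = smult (d w) p + [:- w, 1:] * T p"
begin

lemma leibniz: "leibniz_rule T"
  unfolding leibniz_rule_def
proof (intro allI)
  fix p q
  show "T (p * q) = T p * q + p * T q"
  proof (induction p rule: complex_poly_linear_factor_induct)
    case (const a)
    then show ?case
      by (simp add: const_eq_0 smult_eq)
  next
    case (factor w p)
    have "T ([:- w, 1:] * p * q) = smult (d w) (p * q) + [:- w, 1:] * T (p * q)"
      using factor_eq [of w "p * q"] by (simp only: mult.assoc)
    also have "\<dots> = (smult (d w) p + [:- w, 1:] * T p) * q + [:- w, 1:] * p * T q"
      unfolding factor by (simp add: algebra_simps)
    finally show ?case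
      by (simp only: factor_eq)
  qed
qed

lemma eq_0_or_degree_less: "T p = 0 \<or> degree (T p) < degree p"
proof (induction p rule: complex_poly_linear_factor_induct)
  case (const a)
  show ?case
    by (simp add: const_eq_0)
next
  case (factor w p)
  show ?case
  proof (cases "p = 0")
    case True
    then show ?thesis
      using const_eq_0 [of 0] by simp
  next
    case False
    have "degree ([:- w, 1:] * T p) \<le> degree p"
      using factor degree_mult_le [of "[:- w, 1:]" "T p"] by auto
    then have "degree (T ([:- w, 1:] * p)) \<le> degree p"
      unfolding factor_eq by (intro degree_add_le) simp_all
    also have "degree p < degree ([:- w, 1:] * p)"
      using False by (subst degree_mult_eq) auto
    finally show ?thesis ..
  qed
qed

lemma decreases: "decreases_degree T"
  unfolding decreases_degree_def ext_degree_def using eq_0_or_degree_less by auto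

end

text \<open>Each clause of the recursive description compares the formula for a factorisation of \<open>p\<close> with
  the formula for the factorisation obtained from it by scaling or by appending a zero. Different
  factorisations of the same polynomial never have to be compared with each other.\<close>

lemma linear_factor_operator_if_factorization_formula:
  fixes T :: "complex poly \<Rightarrow> complex poly"
  assumes formula: "\<And>p (N :: nat) a zs z. (\<And>z. poly p z = a * (\<Prod>j=1..N. (z - zs j))) \<Longrightarrow>
    poly (T p) z = a * (\<Sum>j=1..N. (\<Prod>i\<in>{1..N} - {j}. (z - zs i)) * d (zs j))"
  shows "linear_factor_operator T d"
proof
  fix a
  show "T [:a:] = 0"
    by (rule poly_ext) (simp add: formula [where p = "[:a:]" and a = a and N = 0])
next
  fix a :: complex and p :: "complex poly"
  obtain b zs and N :: nat where p: "\<And>z. poly p z = b * (\<Prod>j=1..N. (z - zs j))"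
    using complex_poly_factorization [of p] by blast
  have "poly (smult a p) z = (a * b) * (\<Prod>j=1..N. (z - zs j))" for z
    by (simp add: p)
  from formula [OF this] show "T (smult a p) = smult a (T p)"
    by (intro poly_ext) (simp add: formula [OF p])
next
  fix w :: complex and p :: "complex poly"
  obtain a zs and N :: nat where p: "\<And>z. poly p z = a * (\<Prod>j=1..N. (z - zs j))"
    using complex_poly_factorization [of p] by blast
  define zs' where "zs' = zs(Suc N := w)"
  have insert: "{1..Suc N} = insert (Suc N) {1..N}"
    by auto
  have zs': "zs' (Suc N) = w" "\<And>j. j \<in> {1..N} \<Longrightarrow> zs' j = zs j"
    by (auto simp: zs'_def)
  have wp: "poly ([:- w, 1:] * p) z = a * (\<Prod>j=1..Suc N. (z - zs' j))" for z
    by (simp add: p zs' algebra_simps)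
  show "T ([:- w, 1:] * p) = smult (d w) p + [:- w, 1:] * T p"
  proof (rule poly_ext)
    fix z
    have "poly (T ([:- w, 1:] * p)) z =
        a * ((\<Prod>i=1..N. (z - zs' i)) * d w +
          (z - w) * (\<Sum>j=1..N. (\<Prod>i\<in>{1..N} - {j}. (z - zs' i)) * d (zs' j)))"
      unfolding formula [OF wp] insert by (subst sum_prod_except_insert) (auto simp: zs')
    also have "\<dots> = a * ((\<Prod>i=1..N. (z - zs i)) * d w +
          (z - w) * (\<Sum>j=1..N. (\<Prod>i\<in>{1..N} - {j}. (z - zs i)) * d (zs j)))"
      by (simp add: zs')
    also have "\<dots> = poly (smult (d w) p + [:- w, 1:] * T p) z"
      by (simp add: p formula [OF p] algebra_simps)
    finally show "poly (T ([:- w, 1:] * p)) z = poly (smult (d w) p + [:- w, 1:] * T p) z" .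
  qed
qed

theorem corollary1:
  fixes T :: "complex poly \<Rightarrow> complex poly"
  shows "(leibniz_rule T \<and> decreases_degree T \<longleftrightarrow>
           (\<exists>\<psi> \<phi> :: complex \<Rightarrow> complex.
              (\<forall>a b. \<phi> (a * b) = a * \<phi> b + b * \<phi> a) \<and>
              (\<forall>(p :: complex poly) (N :: nat) (a :: complex) (zs :: nat \<Rightarrow> complex).
                 (\<forall>z. poly p z = a * (\<Prod>j=1..N. (z - zs j))) \<longrightarrow>
                 (\<forall>z. poly (T p) z =
                    a * (\<Sum>j=1..N. (\<Prod>i\<in>{1..N} - {j}. (z - zs i)) * (\<psi> (- zs j) + \<phi> (- zs j)))))))
         \<and> (leibniz_rule T \<and> decreases_degree T \<longrightarrow>
              (\<forall>N :: nat. \<exists>c :: complex. T (monom 1 N) = smult c (pderiv (monom 1 N))))"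
proof (intro conjI iffI impI allI)
  assume "leibniz_rule T \<and> decreases_degree T"
  then have T: "leibniz_rule T" "decreases_degree T"
    by simp_all
  have "\<exists>c. T [:- w, 1:] = [:c:]" for w
    using decreases_degree_linear [OF T(2)] by blast
  then obtain d where d: "\<And>w. T [:- w, 1:] = [:d w:]"
    by metis
  show "\<exists>\<psi> \<phi> :: complex \<Rightarrow> complex.
      (\<forall>a b. \<phi> (a * b) = a * \<phi> b + b * \<phi> a) \<and>
      (\<forall>(p :: complex poly) (N :: nat) (a :: complex) (zs :: nat \<Rightarrow> complex).
         (\<forall>z. poly p z = a * (\<Prod>j=1..N. (z - zs j))) \<longrightarrow>
         (\<forall>z. poly (T p) z =
            a * (\<Sum>j=1..N. (\<Prod>i\<in>{1..N} - {j}. (z - zs i)) * (\<psi> (- zs j) + \<phi> (- zs j)))))"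
    by (rule exI [of _ "\<lambda>x. d (- x)"], rule exI [of _ "\<lambda>x. 0"])
      (simp add: leibniz_rule_factorization [OF T d])
next
  assume "\<exists>\<psi> \<phi> :: complex \<Rightarrow> complex.
      (\<forall>a b. \<phi> (a * b) = a * \<phi> b + b * \<phi> a) \<and>
      (\<forall>(p :: complex poly) (N :: nat) (a :: complex) (zs :: nat \<Rightarrow> complex).
         (\<forall>z. poly p z = a * (\<Prod>j=1..N. (z - zs j))) \<longrightarrow>
         (\<forall>z. poly (T p) z =
            a * (\<Sum>j=1..N. (\<Prod>i\<in>{1..N} - {j}. (z - zs i)) * (\<psi> (- zs j) + \<phi> (- zs j)))))"
  then obtain \<psi> \<phi> :: "complex \<Rightarrow> complex" where formula:
    "\<forall>p (N :: nat) a zs. (\<forall>z. poly p z = a * (\<Prod>j=1..N. (z - zs j))) \<longrightarrow> (\<forall>z. poly (T p) z =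
      a * (\<Sum>j=1..N. (\<Prod>i\<in>{1..N} - {j}. (z - zs i)) * (\<psi> (- zs j) + \<phi> (- zs j))))"
    by blast
  have "linear_factor_operator T (\<lambda>w. \<psi> (- w) + \<phi> (- w))"
    by (rule linear_factor_operator_if_factorization_formula) (rule formula [rule_format])
  then show "leibniz_rule T" and "decreases_degree T"
    by (fact linear_factor_operator.leibniz, fact linear_factor_operator.decreases)
next
  fix N :: nat
  assume T: "leibniz_rule T \<and> decreases_degree T"
  then obtain c where "T [:0, 1:] = [:c:]"
    using decreases_degree_linear by blast
  with T show "\<exists>c. T (monom 1 N) = smult c (pderiv (monom 1 N))"
    using leibniz_rule_monom by blast
qed

end
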